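(* Let $\alpha>-1$ be real and let $\{P_n\}_{n\ge0}$ be the polynomial set generated by $$(1-t)^{-\alpha-1}\exp\left(x\,\frac{t^2-2t}{2(1-t)^2}\right)=\sum_{n=0}^{\infty}P_n(x)\frac{t^n}{n!}.$$ For $f\in\mathcal P$ and real $a>-1$ put $$\Psi_{a,f}(x)=\frac{x^{a}}{\Gamma(a+1)}\sum_{k=0}^{\infty}\frac{f^{(k)}(0)}{k!\left(\frac{a+2}{2}\right)_k}\left(\frac{x^2}{2}\right)^k ,\qquad x>0.$$ Then $\{P_n\}_{n\ge0}$ is $2$-orthogonal with respect to the functional vector $(u_0,u_1)$ of linear functionals given, for $f\in\mathcal P$, by $$\langle u_0,f\rangle=\int_0^\infty \Psi_{\alpha,f}(x)e^{-x}\,dx,\qquad \langle u_1,f\rangle=\int_0^\infty\left[\Psi_{\alpha,f}(x)-\Psi_{\alpha+1,f}(x)\right]e^{-x}\,dx .$$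
   Context: $\mathcal P$ is the vector space of polynomials in $x$ with complex coefficients and $\mathcal P'$ is its algebraic dual; $\langle u,f\rangle$ denotes the value of $u\in\mathcal P'$ at $f\in\mathcal P$. A polynomial set is a sequence $\{P_n\}_{n\ge0}$ in $\mathcal P$ with $\deg P_n=n$ for all $n\ge0$. For a positive integer $d$, a polynomial set $\{P_n\}_{n\ge0}$ is $d$-orthogonal with respect to a $d$-dimensional functional vector $(u_0,\dots,u_{d-1})$, $u_k\in\mathcal P'$, if for every $k\in\{0,1,\dots,d-1\}$ and every integer $n\ge0$: $\langle u_k,P_nP_m\rangle=0$ for all $m>nd+k$, and $\langle u_k,P_nP_{nd+k}\rangle\neq0$. Here $d=2$. Generating function identities are identities of formal power series in $t$. $\Gamma$ is the Gamma function, $f^{(k)}$ the $k$-th derivative of $f$, and $(a)_n$ the Pochhammer symbol: $(a)_0=1$, $(a)_n=a(a+1)\cdots(a+n-1)$ for $n\ge1$. *)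

theory Defs
  imports
    "HOL-Analysis.Analysis"
    "HOL-Computational_Algebra.Computational_Algebra"
begin

definition polynomial_set :: "(nat \<Rightarrow> complex poly) \<Rightarrow> bool" where
  "polynomial_set P \<longleftrightarrow> (\<forall>n. degree (P n) = n)"

text \<open>The algebraic dual of the space of complex polynomials.\<close>

definition linear_functional :: "(complex poly \<Rightarrow> complex) \<Rightarrow> bool" where
  "linear_functional u \<longleftrightarrow> Vector_Spaces.linear smult (*) u"

text \<open>The functional vector is given as the list of its components; its length is the
  dimension \<open>d\<close>.\<close>

definition d_orthogonal ::
    "nat \<Rightarrow> (complex poly \<Rightarrow> complex) list \<Rightarrow> (nat \<Rightarrow> complex poly) \<Rightarrow> bool" where
  "d_orthogonal d us P \<longleftrightarrow>
     d > 0 \<and> length us = d \<and> (\<forall>u\<in>set us. linear_functional u) \<and> polynomial_set P \<and>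
     (\<forall>k<d. \<forall>n.
        (\<forall>m>n * d + k. (us ! k) (P n * P m) = 0) \<and>
        (us ! k) (P n * P (n * d + k)) \<noteq> 0)"

text \<open>The formal power series in \<open>t\<close> of
  \<open>(1 - t) powr (- \<alpha> - 1) * exp (x * (t^2 - 2 * t) / (2 * (1 - t)^2))\<close>. Here
  \<^const>\<open>fps_binomial\<close> \<open>c\<close> is the binomial series of \<open>(1 + t) powr c\<close>, and the argument of the
  exponential has zero constant term.\<close>

definition gen_fps :: "real \<Rightarrow> complex \<Rightarrow> complex fps" where
  "gen_fps \<alpha> x =
     (fps_binomial (of_real (- \<alpha> - 1)) oo (- fps_X)) *
     (fps_exp 1 oo (fps_const x * ((fps_X ^ 2 - 2 * fps_X) / (2 * (1 - fps_X) ^ 2))))"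

text \<open>All terms of the series with \<open>k > degree f\<close> vanish.\<close>

definition Psi :: "real \<Rightarrow> complex poly \<Rightarrow> real \<Rightarrow> complex" where
  "Psi a f x =
     of_real (x powr a / Gamma (a + 1)) *
     (\<Sum>k. poly ((pderiv ^^ k) f) 0 / of_real (fact k * pochhammer ((a + 2) / 2) k) *
          of_real ((x ^ 2 / 2) ^ k))"

definition u0 :: "real \<Rightarrow> complex poly \<Rightarrow> complex" where
  "u0 \<alpha> f = (LINT x:{0<..}|lborel. Psi \<alpha> f x * of_real (exp (- x)))"

definition u1 :: "real \<Rightarrow> complex poly \<Rightarrow> complex" where
  "u1 \<alpha> f = (LINT x:{0<..}|lborel. (Psi \<alpha> f x - Psi (\<alpha> + 1) f x) * of_real (exp (- x)))"

text \<open>The integrals exist in the Lebesgue sense, so \<^const>\<open>u0\<close> and \<^const>\<open>u1\<close> never take the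
  default value that the integral has on non-integrable functions.\<close>

lemma Psi_eq_sum:
  "Psi a f x = (\<Sum>k\<le>degree f.
     poly ((pderiv ^^ k) f) 0 / of_real (Gamma (a + 1) * fact k * pochhammer ((a + 2) / 2) k * 2 ^ k) *
     of_real (x powr a * x ^ (2 * k)))"
proof -
  have z: "(pderiv ^^ k) f = 0" if "k \<notin> {..degree f}" for k
    using that by (intro poly_eqI) (simp add: coeff_higher_pderiv coeff_eq_0)
  show ?thesis
    unfolding Psi_def
    by (subst suminf_finite[of "{..degree f}"])
       (simp_all add: z sum_distrib_left power_divide power_mult[symmetric] field_simps)
qed

lemma set_integrable_Psi:
  assumes "a > -1"
  shows "set_integrable lborel {0<..} (\<lambda>x. Psi a f x * of_real (exp (- x)))"
proof -
  have g: "set_integrable lborel {0<..} (\<lambda>x. complex_of_real (x powr a * x ^ (2 * k)) * of_real (exp (- x)))" for k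
  proof -
    have r: "(\<lambda>t. complex_of_real t powr (of_real (a + 2 * k + 1) - 1) / of_real (exp t))
            absolutely_integrable_on {0<..}"
      by (rule absolutely_integrable_Gamma_integral') (use assms in simp)
    have s: "(\<lambda>x. complex_of_real (x powr a * x ^ (2 * k)) * of_real (exp (- x)))
            absolutely_integrable_on {0<..}"
    proof (rule iffD1[OF set_integrable_cong r])
      fix t :: real assume t: "t \<in> {0<..}"
      have "complex_of_real t powr (of_real (a + 2 * k + 1) - 1) = of_real (t powr (a + 2 * k))"
        using t by (simp add: powr_of_real[symmetric])
      also have "t powr (a + 2 * k) = t powr a * t ^ (2 * k)"
        using t powr_realpow[of t "2 * k"] by (simp add: powr_add)
      finally show "complex_of_real t powr (of_real (a + 2 * k + 1) - 1) / of_real (exp t) =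
            complex_of_real (t powr a * t ^ (2 * k)) * of_real (exp (- t))"
        by (simp add: exp_minus field_simps)
    qed simp_all
    have m: "(\<lambda>x. indicator {0<..} x *\<^sub>R (complex_of_real (x powr a * x ^ (2 * k)) * of_real (exp (- x))))
            \<in> borel_measurable lborel"
      by measurable
    show ?thesis
      using s m unfolding set_integrable_def
      by (subst (asm) integrable_completion) simp_all
  qed
  have "set_integrable lborel {0<..} (\<lambda>x. \<Sum>k\<le>degree f.
     (poly ((pderiv ^^ k) f) 0 / of_real (Gamma (a + 1) * fact k * pochhammer ((a + 2) / 2) k * 2 ^ k)) *
     (of_real (x powr a * x ^ (2 * k)) * of_real (exp (- x))))"
    unfolding set_integrable_def scaleR_sum_right
    by (intro Bochner_Integration.integrable_sum
        set_integrable_mult_right[unfolded set_integrable_def] g[unfolded set_integrable_def])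
  also have "(\<lambda>x. \<Sum>k\<le>degree f.
     (poly ((pderiv ^^ k) f) 0 / of_real (Gamma (a + 1) * fact k * pochhammer ((a + 2) / 2) k * 2 ^ k)) *
     (of_real (x powr a * x ^ (2 * k)) * of_real (exp (- x)))) = (\<lambda>x. Psi a f x * of_real (exp (- x)))"
    by (simp only: Psi_eq_sum sum_distrib_right mult.assoc)
  finally show ?thesis .
qed

text \<open>The generating identity, read as one identity of formal power series in \<open>t\<close> for every
  complex \<open>x\<close>, determines the sequence of polynomials.\<close>

lemma gen_fps_ex1:
  "\<exists>!P :: nat \<Rightarrow> complex poly. \<forall>x. gen_fps \<alpha> x = Abs_fps (\<lambda>n. poly (P n) x / fact n)"
proof
  define A :: "complex fps" where "A = fps_binomial (of_real (- \<alpha> - 1)) oo (- fps_X)"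
  define B :: "complex fps" where "B = (fps_X ^ 2 - 2 * fps_X) / (2 * (1 - fps_X) ^ 2)"
  define P where "P = (\<lambda>n. \<Sum>j\<le>n. \<Sum>i\<le>j.
     monom (fact n * fps_nth A (n - j) * fps_nth (B ^ i) j / fact i) i)"
  show *: "\<forall>x. gen_fps \<alpha> x = Abs_fps (\<lambda>n. poly (P n) x / fact n)"
  proof (intro allI fps_ext)
    fix x n
    have c: "fps_nth (fps_exp 1 oo (fps_const x * B)) j =
        (\<Sum>i\<le>j. x ^ i / fact i * fps_nth (B ^ i) j)" for j
      by (simp add: fps_compose_nth power_mult_distrib atLeast0AtMost)
    have "fps_nth (gen_fps \<alpha> x) n =
        fps_nth ((fps_exp 1 oo (fps_const x * B)) * A) n"
      by (simp add: gen_fps_def A_def B_def mult.commute)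
    also have "\<dots> = (\<Sum>j\<le>n. \<Sum>i\<le>j. x ^ i / fact i * fps_nth (B ^ i) j * fps_nth A (n - j))"
      by (simp only: fps_mult_nth c sum_distrib_right atLeast0AtMost)
    also have "\<dots> = poly (P n) x / fact n"
      by (simp add: P_def poly_sum poly_monom sum_divide_distrib mult_ac)
    finally show "fps_nth (gen_fps \<alpha> x) n = fps_nth (Abs_fps (\<lambda>n. poly (P n) x / fact n)) n"
      by simp
  qed
  fix Q :: "nat \<Rightarrow> complex poly"
  assume Q: "\<forall>x. gen_fps \<alpha> x = Abs_fps (\<lambda>n. poly (Q n) x / fact n)"
  show "Q = P"
  proof (rule ext)
    fix n
    have "poly (Q n) x = poly (P n) x" for x
    proof -
      have "fps_nth (Abs_fps (\<lambda>n. poly (Q n) x / fact n)) n =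
            fps_nth (Abs_fps (\<lambda>n. poly (P n) x / fact n)) n"
        using Q * by metis
      then show ?thesis by simp
    qed
    then show "Q n = P n"
      by (simp add: poly_eq_poly_eq_iff[symmetric] fun_eq_iff)
  qed
qed

end

theory Submission
  imports Defs
begin

text \<open>
  Put \<open>A = (1 - t) powr (-\<alpha> - 1)\<close> (\<open>prefactor \<alpha>\<close>) and \<open>B = (t^2 - 2 t) / (2 (1 - t)^2)\<close>
  (\<open>exponent\<close>), so that the generating function is \<open>A exp (x B)\<close> and \<open>1 - 2 B = (1 - t)^(-2)\<close>.

  The factor \<open>1 / (a/2 + 1)\<^sub>k\<close> in \<^const>\<open>Psi\<close> is chosen such that, by the duplication formula for
  Pochhammer symbols, integration against \<open>exp (-x)\<close> turns \<open>x^k\<close> into \<open>2^k ((a + 1) / 2)\<^sub>k\<close>. These are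
  the moments of a gamma distribution, and their exponential generating function is
  \<open>(1 - 2 s) powr (-(a + 1) / 2)\<close>. Applying the functional \<open>u0 \<beta>\<close> to the generating function
  coefficientwise therefore gives \<open>A (1 - 2 B) powr (-(\<beta> + 1) / 2) = (1 - t) powr (\<beta> - \<alpha>)\<close>, which is
  \<open>1\<close> for \<open>\<beta> = \<alpha>\<close> and \<open>1 - t\<close> for \<open>\<beta> = \<alpha> + 1\<close>. So \<open>u0 \<alpha>\<close> and \<open>u1 \<alpha> = u0 \<alpha> - u0 (\<alpha> + 1)\<close> are dual
  to \<open>P 0\<close> and \<open>P 1\<close>: they take the values \<open>\<delta>\<^sub>m\<^sub>0\<close> and \<open>\<delta>\<^sub>m\<^sub>1\<close> at \<open>P m\<close>
  (\<open>transform_nth_same\<close>, \<open>transform_nth_next\<close>).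

  Moreover \<open>G = A exp (x B)\<close> satisfies \<open>(1 - t)^3 G' = ((\<alpha> + 1) (1 - t)^2 - x) G\<close>, which expresses
  \<open>x P n\<close> through \<open>P (n + 1), P n, P (n - 1), P (n - 2)\<close> with outer coefficients \<open>-1\<close> and
  \<open>n (n - 1) (n + \<alpha> - 1)\<close> (\<open>gen_poly_recurrence\<close>). Multiplication by \<open>x\<close> thus lowers the index by at most
  \<open>2\<close>, and exactly by \<open>2\<close> if \<open>n \<ge> 2\<close>. Hence \<open>P n P m\<close> only involves the \<open>P i\<close> with \<open>i \<ge> m - 2 n\<close>, and
  duality gives the 2-orthogonality (\<open>d_orthogonal_of_recurrence\<close>). This is the easy half of the
  theorem of Favard type for \<open>d\<close>-orthogonal polynomials.
\<close>

section \<open>Recurrence relations and \<open>d\<close>-orthogonality\<close>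

lemma linear_functional_iff:
  "linear_functional u \<longleftrightarrow> (\<forall>f g. u (f + g) = u f + u g) \<and> (\<forall>c f. u (smult c f) = c * u f)"
  by (auto simp: linear_functional_def Vector_Spaces.linear_iff vector_space_def algebra_simps
      smult_add_left smult_add_right)

lemma linear_functional_add: "linear_functional u \<Longrightarrow> u (f + g) = u f + u g"
  and linear_functional_smult: "linear_functional u \<Longrightarrow> u (smult c f) = c * u f"
  by (simp_all add: linear_functional_iff)

lemma linear_functional_sum:
  assumes "linear_functional u"
  shows "u (sum f S) = (\<Sum>i\<in>S. u (f i))"
proof -
  have "u 0 = 0"
    using linear_functional_smult[OF assms, of 0 0] by simp
  then show ?thesis
    by (induction S rule: infinite_finite_induct) (simp_all add: linear_functional_add[OF assms])
qed

lemma polynomial_set_of_recurrence: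
  fixes P :: "nat \<Rightarrow> complex poly"
  assumes P0: "P 0 = 1"
    and rec: "\<And>n. pCons 0 (P n) = smult (a n) (P (Suc n)) + (\<Sum>i\<le>d. smult (c n i) (P (n - i)))"
    and a: "\<And>n. a n \<noteq> 0"
  shows "polynomial_set P"
proof -
  have "degree (P n) = n" for n
  proof (induction n rule: less_induct)
    case (less n)
    show ?case
    proof (cases n)
      case 0
      then show ?thesis by (simp add: P0)
    next
      case (Suc m)
      have "P m \<noteq> 0"
        using P0 less.IH[of m] Suc by (cases "m = 0") auto
      then have 1: "degree (pCons 0 (P m)) = n"
        using less.IH[of m] Suc by simp
      have "degree (\<Sum>i\<le>d. smult (c m i) (P (m - i))) \<le> m"
      proof (rule degree_sum_le)
        fix i
        have "degree (smult (c m i) (P (m - i))) \<le> m - i"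
          using less.IH[of "m - i"] Suc by simp
        then show "degree (smult (c m i) (P (m - i))) \<le> m"
          by linarith
      qed simp
      then have "degree (pCons 0 (P m) + - (\<Sum>i\<le>d. smult (c m i) (P (m - i)))) = n"
        using 1 Suc by (subst degree_add_eq_left) simp_all
      moreover have "pCons 0 (P m) + - (\<Sum>i\<le>d. smult (c m i) (P (m - i))) = smult (a m) (P n)"
        unfolding rec Suc by simp
      ultimately show ?thesis
        using a[of m] by simp
    qed
  qed
  then show ?thesis
    by (simp add: polynomial_set_def)
qed

text \<open>Each factor \<open>x\<close> lowers the index by at most \<open>d\<close>, so \<open>x^j P m\<close> reaches \<open>P k\<close> only from
  \<open>m \<le> d j + k\<close>. In the boundary case only the product of the lowest recurrence coefficients
  contributes.\<close>

lemma functional_monom_mult: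
  fixes P :: "nat \<Rightarrow> complex poly"
  assumes u: "linear_functional u"
    and rec: "\<And>n. pCons 0 (P n) = smult (a n) (P (Suc n)) + (\<Sum>i\<le>d. smult (c n i) (P (n - i)))"
    and c: "\<And>n. n \<ge> d \<Longrightarrow> c n d \<noteq> 0"
    and zero: "\<And>m. m > k \<Longrightarrow> u (P m) = 0"
    and nonzero: "u (P k) \<noteq> 0"
  shows "(\<forall>m>d * j + k. u (monom 1 j * P m) = 0) \<and> u (monom 1 j * P (d * j + k)) \<noteq> 0"
proof (induction j)
  case 0
  then show ?case
    using zero nonzero by (simp flip: one_poly_eq_simps(1) add: monom_0)
next
  case (Suc j)
  \<comment> \<open>After one factor \<open>x\<close>, the induction hypothesis kills every term but the lowest one.\<close>
  have step: "u (monom 1 (Suc j) * P m) = c m d * u (monom 1 j * P (m - d))"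
    if m: "m \<ge> d * Suc j + k" for m
  proof -
    have "monom 1 (Suc j) * P m = monom 1 j * pCons 0 (P m)"
      by (simp add: monom_Suc)
    also have "\<dots> = smult (a m) (monom 1 j * P (Suc m)) +
        (\<Sum>i\<le>d. smult (c m i) (monom 1 j * P (m - i)))"
      unfolding rec by (simp add: distrib_left sum_distrib_left)
    finally have "u (monom 1 (Suc j) * P m) = a m * u (monom 1 j * P (Suc m)) +
        (\<Sum>i\<le>d. c m i * u (monom 1 j * P (m - i)))"
      by (simp add: linear_functional_add[OF u] linear_functional_sum[OF u]
          linear_functional_smult[OF u])
    also have "(\<Sum>i\<le>d. c m i * u (monom 1 j * P (m - i))) =
        c m d * u (monom 1 j * P (m - d)) + (\<Sum>i<d. c m i * u (monom 1 j * P (m - i)))"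
      by (simp flip: lessThan_Suc_atMost)
    also have "(\<Sum>i<d. c m i * u (monom 1 j * P (m - i))) = 0"
      using Suc.IH m by (intro sum.neutral) auto
    finally show ?thesis
      using Suc.IH m by simp
  qed
  have "u (monom 1 (Suc j) * P m) = 0" if "m > d * Suc j + k" for m
    using step[of m] Suc.IH that by simp
  moreover have "u (monom 1 (Suc j) * P (d * Suc j + k)) \<noteq> 0"
    using step[of "d * Suc j + k"] Suc.IH c[of "d * Suc j + k"] by simp
  ultimately show ?case by blast
qed

text \<open>When \<open>i > n\<close>, the index \<open>n - i\<close> is truncated to \<open>0\<close>; this is harmless because such terms only
  occur for \<open>n < d\<close>, where the recurrence is used for degrees alone.\<close>

lemma d_orthogonal_of_recurrence:
  fixes P :: "nat \<Rightarrow> complex poly"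
  assumes d: "d > 0" "length us = d" and lin: "\<And>u. u \<in> set us \<Longrightarrow> linear_functional u"
    and P0: "P 0 = 1"
    and rec: "\<And>n. pCons 0 (P n) = smult (a n) (P (Suc n)) + (\<Sum>i\<le>d. smult (c n i) (P (n - i)))"
    and a: "\<And>n. a n \<noteq> 0" and c: "\<And>n. n \<ge> d \<Longrightarrow> c n d \<noteq> 0"
    and zero: "\<And>k m. k < d \<Longrightarrow> m > k \<Longrightarrow> (us ! k) (P m) = 0"
    and nonzero: "\<And>k. k < d \<Longrightarrow> (us ! k) (P k) \<noteq> 0"
  shows "d_orthogonal d us P"
proof -
  have set: "polynomial_set P"
    using polynomial_set_of_recurrence[of P a c d] P0 rec a by blast
  then have deg: "degree (P n) = n" for n
    by (simp add: polynomial_set_def)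
  have "(\<forall>m>n * d + k. (us ! k) (P n * P m) = 0) \<and> (us ! k) (P n * P (n * d + k)) \<noteq> 0"
    if k: "k < d" for k n
  proof -
    define u where "u = us ! k"
    have u: "linear_functional u"
      using lin d k by (simp add: u_def)
    have shift: "(\<forall>m>d * j + k. u (monom 1 j * P m) = 0) \<and> u (monom 1 j * P (d * j + k)) \<noteq> 0"
      for j
      by (rule functional_monom_mult[OF u rec c]) (use zero nonzero k in \<open>simp_all add: u_def\<close>)
    \<comment> \<open>Powers \<open>x^i\<close> with \<open>i < n\<close> cannot lower the index \<open>m\<close> as far as \<open>k\<close>.\<close>
    have lead: "u (P n * P m) = lead_coeff (P n) * u (monom 1 n * P m)" if m: "m \<ge> n * d + k" for m
    proof -
      have "P n * P m = (\<Sum>i\<le>n. smult (coeff (P n) i) (monom 1 i * P m))"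
        by (subst poly_as_sum_of_monoms[of "P n", symmetric])
           (simp add: deg sum_distrib_right smult_monom flip: mult_smult_left)
      then have "u (P n * P m) = (\<Sum>i\<le>n. coeff (P n) i * u (monom 1 i * P m))"
        by (simp add: linear_functional_sum[OF u] linear_functional_smult[OF u])
      also have "\<dots> = coeff (P n) n * u (monom 1 n * P m) +
          (\<Sum>i<n. coeff (P n) i * u (monom 1 i * P m))"
        by (simp flip: lessThan_Suc_atMost)
      also have "(\<Sum>i<n. coeff (P n) i * u (monom 1 i * P m)) = 0"
      proof (rule sum.neutral, rule ballI)
        fix i assume "i \<in> {..<n}"
        then have "d * i < n * d"
          using d by (simp add: mult.commute)
        then have "d * i + k < m"
          using m by linarith
        then show "coeff (P n) i * u (monom 1 i * P m) = 0"
          using shift[of i] by simp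
      qed
      finally show ?thesis by (simp add: deg)
    qed
    have "P n \<noteq> 0"
      using P0 deg[of n] by (cases "n = 0") auto
    then have "lead_coeff (P n) \<noteq> 0"
      by simp
    then show ?thesis
      using lead shift[of n] by (simp add: u_def[symmetric] mult.commute[of n d])
  qed
  then show ?thesis
    unfolding d_orthogonal_def using d lin set by auto
qed

section \<open>Moments of the functionals\<close>

definition moment_functional :: "(nat \<Rightarrow> complex) \<Rightarrow> complex poly \<Rightarrow> complex" where
  "moment_functional \<mu> f = (\<Sum>k\<le>degree f. coeff f k * \<mu> k)"

lemma moment_functional_eq:
  assumes "degree f \<le> n"
  shows "moment_functional \<mu> f = (\<Sum>k\<le>n. coeff f k * \<mu> k)"
  unfolding moment_functional_def
  by (rule sum.mono_neutral_left) (use assms in \<open>auto simp: coeff_eq_0\<close>)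

lemma linear_functional_moment_functional: "linear_functional (moment_functional \<mu>)"
  unfolding linear_functional_iff
proof safe
  fix f g :: "complex poly"
  let ?n = "max (degree f) (degree g)"
  show "moment_functional \<mu> (f + g) = moment_functional \<mu> f + moment_functional \<mu> g"
    by (simp add: moment_functional_eq[of _ ?n] degree_add_le distrib_right sum.distrib)
next
  fix c :: complex and f :: "complex poly"
  show "moment_functional \<mu> (smult c f) = c * moment_functional \<mu> f"
    by (simp add: moment_functional_eq[of _ "degree f"] sum_distrib_left mult.assoc)
qed

text \<open>For \<open>\<beta> > -1\<close> these are the moments of the gamma distribution with shape \<open>(\<beta> + 1) / 2\<close> and
  scale \<open>2\<close>.\<close>

definition gamma_moment :: "real \<Rightarrow> nat \<Rightarrow> complex" where
  "gamma_moment \<beta> k = of_real (2 ^ k * pochhammer ((\<beta> + 1) / 2) k)"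

lemma gamma_moment_Suc:
  "gamma_moment \<beta> (Suc k) = (of_real (\<beta> + 1) + 2 * of_nat k) * gamma_moment \<beta> k"
  by (simp add: gamma_moment_def pochhammer_Suc field_simps)

text \<open>The duplication formula splits \<open>\<Gamma>(a + 2k + 1) / \<Gamma>(a + 1) = (a + 1)\<^sub>2\<^sub>k\<close> into two Pochhammer
  symbols, one of which is the denominator in \<^const>\<open>Psi\<close>.\<close>

lemma Gamma_quotient_eq_moment:
  assumes a: "a > -1"
  shows "Gamma (a + 2 * real k + 1) / (Gamma (a + 1) * pochhammer ((a + 2) / 2) k * 2 ^ k) =
    2 ^ k * pochhammer ((a + 1) / 2) k"
proof -
  have "a + 1 \<notin> \<int>\<^sub>\<le>\<^sub>0"
    using a by (auto elim!: nonpos_Ints_cases)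
  then have "pochhammer (a + 1) (2 * k) = Gamma (a + 1 + of_nat (2 * k)) / Gamma (a + 1)"
    by (rule pochhammer_Gamma)
  then have "Gamma (a + 2 * real k + 1) / Gamma (a + 1) = pochhammer (a + 1) (2 * k)"
    by (simp add: add_ac)
  also have "\<dots> = 4 ^ k * pochhammer ((a + 1) / 2) k * pochhammer ((a + 2) / 2) k"
  proof -
    have "2 * ((a + 1) / 2) = a + 1" "(a + 1) / 2 + 1 / 2 = (a + 2) / 2"
      by (simp_all only: add_divide_distrib) simp_all
    then show ?thesis
      using pochhammer_double[of "(a + 1) / 2" k] by (simp only: power_mult) simp
  qed
  finally have *: "Gamma (a + 2 * real k + 1) / Gamma (a + 1) = \<dots>" .
  have "pochhammer ((a + 2) / 2) k > 0"
    using a by (intro pochhammer_pos) simp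
  moreover have "(4 :: real) ^ k = 2 ^ k * 2 ^ k"
    by (simp flip: power_mult_distrib)
  moreover have "Gamma (a + 1) > 0"
    using a by (intro Gamma_real_pos) simp
  ultimately show ?thesis
    using * by (simp add: field_simps)
qed

lemma u0_eq_moment_functional:
  assumes a: "a > -1"
  shows "u0 a = moment_functional (gamma_moment a)"
proof
  fix f
  have int: "((\<lambda>x. complex_of_real (x powr a * x ^ (2 * k)) * of_real (exp (- x)))
      has_integral of_real (Gamma (a + 2 * real k + 1))) {0<..}" for k
  proof (rule has_integral_eq)
    show "((\<lambda>t. complex_of_real t powr (of_real (a + 2 * real k + 1) - 1) / of_real (exp t))
        has_integral of_real (Gamma (a + 2 * real k + 1))) {0<..}"
      using Gamma_integral_complex'[of "of_real (a + 2 * real k + 1)"] a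
      by (simp flip: Gamma_complex_of_real)
    fix t :: real assume t: "t \<in> {0<..}"
    have "complex_of_real t powr (of_real (a + 2 * real k + 1) - 1) = of_real (t powr (a + 2 * k))"
      using t by (simp add: powr_of_real[symmetric])
    also have "t powr (a + 2 * k) = t powr a * t ^ (2 * k)"
      using t powr_realpow[of t "2 * k"] by (simp add: powr_add)
    finally show "complex_of_real t powr (of_real (a + 2 * real k + 1) - 1) / of_real (exp t) =
        complex_of_real (t powr a * t ^ (2 * k)) * of_real (exp (- t))"
      by (simp add: exp_minus field_simps)
  qed
  let ?w = "\<lambda>k. poly ((pderiv ^^ k) f) 0 /
    complex_of_real (Gamma (a + 1) * fact k * pochhammer ((a + 2) / 2) k * 2 ^ k)"
  have "((\<lambda>x. \<Sum>k\<le>degree f. ?w k * (of_real (x powr a * x ^ (2 * k)) * of_real (exp (- x))))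
      has_integral (\<Sum>k\<le>degree f. ?w k * of_real (Gamma (a + 2 * real k + 1)))) {0<..}"
    by (intro has_integral_sum has_integral_mult_right int) simp
  also have "(\<lambda>x. \<Sum>k\<le>degree f. ?w k * (of_real (x powr a * x ^ (2 * k)) * of_real (exp (- x)))) =
      (\<lambda>x. Psi a f x * of_real (exp (- x)))"
    by (simp only: Psi_eq_sum sum_distrib_right mult.assoc)
  also have "(\<Sum>k\<le>degree f. ?w k * of_real (Gamma (a + 2 * real k + 1))) =
      moment_functional (gamma_moment a) f"
    unfolding moment_functional_def
  proof (rule sum.cong)
    fix k
    have "poly ((pderiv ^^ k) f) 0 = fact k * coeff f k"
      by (simp add: poly_0_coeff_0 coeff_higher_pderiv pochhammer_fact[symmetric])
    then have "?w k * of_real (Gamma (a + 2 * real k + 1)) = coeff f k *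
        of_real (Gamma (a + 2 * real k + 1) / (Gamma (a + 1) * pochhammer ((a + 2) / 2) k * 2 ^ k))"
      by simp
    then show "?w k * of_real (Gamma (a + 2 * real k + 1)) = coeff f k * gamma_moment a k"
      by (simp only: Gamma_quotient_eq_moment[OF a] gamma_moment_def)
  qed simp
  finally show "u0 a f = moment_functional (gamma_moment a) f"
    unfolding u0_def using set_borel_integral_eq_integral(2)[OF set_integrable_Psi[OF a]]
    by (simp add: integral_unique)
qed

lemma u1_eq_diff_u0:
  assumes "\<alpha> > -1"
  shows "u1 \<alpha> f = u0 \<alpha> f - u0 (\<alpha> + 1) f"
  unfolding u0_def u1_def left_diff_distrib
  by (rule set_integral_diff(2)) (use assms in \<open>simp_all add: set_integrable_Psi\<close>)

section \<open>Differential equations for the generating function\<close>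

text \<open>The coefficients of \<open>f\<close> enter \<open>g (f \<circ> c)\<close> linearly. The generating function arises
  from \<open>f = exp (x s)\<close>, a series in \<open>s\<close> with coefficients \<open>x^i / i!\<close>, so putting moments in place of
  the \<open>x^i\<close> only changes \<open>f\<close>.\<close>

lemma fps_nth_mult_compose:
  fixes f g c :: "'a :: idom fps"
  assumes "fps_nth c 0 = 0"
  shows "fps_nth (g * (f oo c)) n = (\<Sum>i\<le>n. fps_nth f i * fps_nth (g * c ^ i) n)"
proof -
  have vanish: "fps_nth (c ^ i) j = 0" if "j < i" for i j
    using that assms by (intro startsby_zero_power_prefix[rule_format]) simp_all
  have *: "fps_nth (f oo c) j = (\<Sum>i\<le>n. fps_nth f i * fps_nth (c ^ i) j)" if "j \<le> n" for j
    unfolding fps_compose_nth atLeast0AtMost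
    using that vanish by (intro sum.mono_neutral_left) auto
  have "fps_nth (g * (f oo c)) n =
      (\<Sum>j\<le>n. fps_nth g j * (\<Sum>i\<le>n. fps_nth f i * fps_nth (c ^ i) (n - j)))"
    by (simp add: fps_mult_nth * atLeast0AtMost)
  also have "\<dots> = (\<Sum>i\<le>n. fps_nth f i * fps_nth (g * c ^ i) n)"
    by (simp only: fps_mult_nth sum_distrib_left atLeast0AtMost, subst sum.swap)
       (simp add: mult_ac)
  finally show ?thesis .
qed

definition prefactor :: "real \<Rightarrow> complex fps" where
  "prefactor \<alpha> = fps_binomial (of_real (- \<alpha> - 1)) oo (- fps_X)"

definition exponent :: "complex fps" where
  "exponent = (fps_X ^ 2 - 2 * fps_X) / (2 * (1 - fps_X) ^ 2)"

text \<open>The exponential generating function of the gamma moments, that is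
  \<open>(1 - 2 s) powr (-(\<beta> + 1) / 2)\<close>.\<close>

definition moment_fps :: "real \<Rightarrow> complex fps" where
  "moment_fps \<beta> = Abs_fps (\<lambda>k. gamma_moment \<beta> k / fact k)"

lemma gen_fps_eq: "gen_fps \<alpha> x = prefactor \<alpha> * (fps_exp 1 oo (fps_const x * exponent))"
  by (simp add: gen_fps_def prefactor_def exponent_def)

lemma prefactor_nth_0 [simp]: "fps_nth (prefactor \<alpha>) 0 = 1"
  by (simp add: prefactor_def)

lemma prefactor_deriv:
  "(1 - fps_X) * fps_deriv (prefactor \<alpha>) = fps_const (of_real (\<alpha> + 1)) * prefactor \<alpha>"
proof -
  let ?c = "complex_of_real (- \<alpha> - 1)"
  have "(1 + fps_X) * fps_deriv (fps_binomial ?c) = fps_const ?c * fps_binomial ?c"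
    by (simp add: fps_binomial_deriv fps_divide_unit)
       (simp add: mult_ac inverse_mult_eq_1' flip: mult.assoc)
  then have "((1 + fps_X) * fps_deriv (fps_binomial ?c)) oo - fps_X =
      (fps_const ?c * fps_binomial ?c) oo (- fps_X)"
    by simp
  then have *: "(1 - fps_X) * (fps_deriv (fps_binomial ?c) oo - fps_X) = fps_const ?c * prefactor \<alpha>"
    by (simp add: fps_compose_mult_distrib fps_compose_add_distrib prefactor_def)
  have "(1 - fps_X) * fps_deriv (prefactor \<alpha>) = - ((1 - fps_X) * (fps_deriv (fps_binomial ?c) oo - fps_X))"
    by (simp add: prefactor_def fps_compose_deriv)
  also have "\<dots> = fps_const (- ?c) * prefactor \<alpha>"
    unfolding * by (simp only: fps_const_neg[symmetric] mult_minus_left)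
  finally show ?thesis by (simp add: add.commute)
qed

lemma exponent_eq: "2 * exponent * (1 - fps_X) ^ 2 = (1 - fps_X) ^ 2 - 1"
proof -
  have "(2 * (1 - fps_X) ^ 2 :: complex fps) dvd 1"
    by (simp add: fps_power_zeroth)
  then have "(2 * (1 - fps_X) ^ 2 :: complex fps) dvd fps_X ^ 2 - 2 * fps_X"
    using dvd_trans one_dvd by blast
  then have "exponent * (2 * (1 - fps_X) ^ 2) = fps_X ^ 2 - 2 * fps_X"
    unfolding exponent_def by (rule dvd_div_mult_self)
  then show ?thesis
    by (simp add: power2_eq_square algebra_simps)
qed

lemma exponent_nth_0 [simp]: "fps_nth exponent 0 = 0"
  using arg_cong[OF exponent_eq, of "\<lambda>f. fps_nth f 0"] by (simp add: fps_power_zeroth)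

lemma exponent_deriv: "(1 - fps_X) ^ 3 * fps_deriv exponent = -1"
proof -
  let ?Y = "1 - fps_X :: complex fps"
  have "fps_deriv (2 * exponent * ?Y ^ 2) = fps_deriv (?Y ^ 2 - 1)"
    by (simp only: exponent_eq)
  then have "2 * (?Y ^ 2 * fps_deriv exponent) = 2 * (?Y * (2 * exponent - 1))"
    by (simp add: power2_eq_square algebra_simps)
  then have "?Y ^ 2 * fps_deriv exponent = ?Y * (2 * exponent - 1)"
    by (simp only: mult_cancel_left) simp
  then have "?Y ^ 3 * fps_deriv exponent = 2 * exponent * ?Y ^ 2 - ?Y ^ 2"
    by algebra
  then show ?thesis by (simp add: exponent_eq)
qed

text \<open>The power \<open>(1 - t)^3\<close> is the common denominator of \<open>A' / A = (\<alpha> + 1) / (1 - t)\<close> and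
  \<open>B' = -(1 - t)^(-3)\<close>. Clearing it makes the resulting recurrence finite.\<close>

lemma gen_fps_deriv:
  "(1 - fps_X) ^ 3 * fps_deriv (gen_fps \<alpha> x) =
     (fps_const (of_real (\<alpha> + 1)) * (1 - fps_X) ^ 2 - fps_const x) * gen_fps \<alpha> x"
proof -
  let ?Y = "1 - fps_X :: complex fps"
  define E where "E = fps_exp 1 oo (fps_const x * exponent)"
  have E: "fps_deriv E = fps_const x * fps_deriv exponent * E"
    by (simp add: E_def fps_compose_deriv mult_ac)
  have G: "gen_fps \<alpha> x = prefactor \<alpha> * E"
    by (simp add: gen_fps_eq E_def)
  have "?Y ^ 3 * fps_deriv (gen_fps \<alpha> x) =
      ?Y ^ 2 * (?Y * fps_deriv (prefactor \<alpha>)) * E +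
      (?Y ^ 3 * fps_deriv exponent) * fps_const x * (prefactor \<alpha> * E)"
    unfolding G fps_deriv_mult E
    by (simp only: power3_eq_cube power2_eq_square distrib_left distrib_right mult_ac)
       (simp add: add_ac)
  then show ?thesis
    unfolding prefactor_deriv exponent_deriv G by algebra
qed

lemma moment_fps_deriv:
  "(1 - 2 * fps_X) * fps_deriv (moment_fps \<beta>) = fps_const (of_real (\<beta> + 1)) * moment_fps \<beta>"
proof (rule fps_ext)
  fix n
  have *: "of_nat (Suc k) * (gamma_moment \<beta> (Suc k) / fact (Suc k)) =
      (of_real (\<beta> + 1) + 2 * of_nat k) * (gamma_moment \<beta> k / fact k)" for k
    by (simp add: gamma_moment_Suc divide_simps del: of_nat_Suc)
  have "fps_nth ((1 - 2 * fps_X) * fps_deriv (moment_fps \<beta>)) n =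
      fps_nth (fps_deriv (moment_fps \<beta>)) n - 2 * fps_nth (fps_X * fps_deriv (moment_fps \<beta>)) n"
    by (simp add: left_diff_distrib mult.assoc fps_numeral_fps_const)
  also have "fps_nth (fps_X * fps_deriv (moment_fps \<beta>)) n = of_nat n * fps_nth (moment_fps \<beta>) n"
    by (cases n) simp_all
  also have "fps_nth (fps_deriv (moment_fps \<beta>)) n =
      (of_real (\<beta> + 1) + 2 * of_nat n) * fps_nth (moment_fps \<beta>) n"
    using *[of n] by (simp only: fps_deriv_nth moment_fps_def fps_nth_Abs_fps Suc_eq_plus1)
  finally show "fps_nth ((1 - 2 * fps_X) * fps_deriv (moment_fps \<beta>)) n =
      fps_nth (fps_const (of_real (\<beta> + 1)) * moment_fps \<beta>) n"
    by (simp add: algebra_simps)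
qed

text \<open>The coefficients of this series are the values at the \<open>P n / n!\<close> of the functional with
  moments \<^term>\<open>gamma_moment \<beta>\<close>.\<close>

definition transform :: "real \<Rightarrow> real \<Rightarrow> complex fps" where
  "transform \<alpha> \<beta> = prefactor \<alpha> * (moment_fps \<beta> oo exponent)"

text \<open>Substitution turns \<open>(1 - 2 s) powr (-(\<beta> + 1) / 2)\<close> into \<open>(1 - t) powr (\<beta> + 1)\<close>, because
  \<open>1 - 2 B = (1 - t)^(-2)\<close>. The equation is therefore the one of \<open>(1 - t) powr (\<beta> - \<alpha>)\<close>.\<close>

lemma transform_deriv:
  "(1 - fps_X) * fps_deriv (transform \<alpha> \<beta>) = fps_const (of_real (\<alpha> - \<beta>)) * transform \<alpha> \<beta>"
proof -
  let ?Y = "1 - fps_X :: complex fps"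
  let ?b = "fps_const (of_real (\<beta> + 1)) :: complex fps"
  define y where "y = moment_fps \<beta> oo exponent"
  define y' where "y' = fps_deriv (moment_fps \<beta>) oo exponent"
  have "((1 - 2 * fps_X) * fps_deriv (moment_fps \<beta>)) oo exponent = (?b * moment_fps \<beta>) oo exponent"
    by (simp only: moment_fps_deriv)
  then have "(1 - 2 * exponent) * y' = ?b * y"
    by (simp add: fps_compose_mult_distrib fps_compose_sub_distrib y_def y'_def)
  moreover have "?Y ^ 2 * (1 - 2 * exponent) = 1"
    using exponent_eq by (simp add: algebra_simps)
  moreover have "(?Y ^ 2 * (1 - 2 * exponent)) * y' = ?Y ^ 2 * ((1 - 2 * exponent) * y')"
    by (simp only: mult.assoc)
  ultimately have y': "y' = ?Y ^ 2 * ?b * y"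
    by (simp add: mult.assoc)
  have "fps_deriv y = y' * fps_deriv exponent"
    by (simp add: y_def y'_def fps_compose_deriv)
  then have "?Y * fps_deriv y = (?Y ^ 3 * fps_deriv exponent) * ?b * y"
    by (simp add: y' power3_eq_cube power2_eq_square mult_ac)
  then have y: "?Y * fps_deriv y = - (?b * y)"
    by (simp only: exponent_deriv mult_minus_left mult_1)
  have h: "transform \<alpha> \<beta> = prefactor \<alpha> * y"
    by (simp add: transform_def y_def)
  have "?Y * fps_deriv (transform \<alpha> \<beta>) =
      (?Y * fps_deriv (prefactor \<alpha>)) * y + prefactor \<alpha> * (?Y * fps_deriv y)"
    by (simp only: h fps_deriv_mult distrib_left mult_ac add_ac)
  also have "\<dots> = (fps_const (of_real (\<alpha> + 1)) - ?b) * transform \<alpha> \<beta>"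
    unfolding prefactor_deriv y h by algebra
  also have "fps_const (of_real (\<alpha> + 1)) - ?b = fps_const (of_real (\<alpha> - \<beta>))"
    by (simp only: fps_const_sub) simp
  finally show ?thesis .
qed

lemma transform_nth_0 [simp]: "fps_nth (transform \<alpha> \<beta>) 0 = 1"
  by (simp add: transform_def moment_fps_def gamma_moment_def)

lemma transform_nth_Suc:
  "fps_nth (transform \<alpha> \<beta>) (Suc n) =
     (of_nat n + of_real (\<alpha> - \<beta>)) / of_nat (Suc n) * fps_nth (transform \<alpha> \<beta>) n"
proof -
  have "fps_nth ((1 - fps_X) * fps_deriv (transform \<alpha> \<beta>)) n =
      of_real (\<alpha> - \<beta>) * fps_nth (transform \<alpha> \<beta>) n"
    by (simp add: transform_deriv)
  then have "of_nat (Suc n) * fps_nth (transform \<alpha> \<beta>) (Suc n) =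
      (of_nat n + of_real (\<alpha> - \<beta>)) * fps_nth (transform \<alpha> \<beta>) n"
    by (cases n) (simp_all add: algebra_simps)
  then show ?thesis
    by (simp add: field_simps del: of_nat_Suc)
qed

lemma transform_nth_same: "fps_nth (transform \<alpha> \<alpha>) n = (if n = 0 then 1 else 0)"
  by (induction n) (simp_all add: transform_nth_Suc)

lemma transform_nth_next:
  "fps_nth (transform \<alpha> (\<alpha> + 1)) n = (if n = 0 then 1 else if n = 1 then -1 else 0)"
  by (induction n) (simp_all add: transform_nth_Suc)

section \<open>The generated polynomials\<close>

context
  fixes \<alpha> :: real and P :: "nat \<Rightarrow> complex poly"
  assumes gen: "\<And>x :: complex. gen_fps \<alpha> x = Abs_fps (\<lambda>n. poly (P n) x / fact n)"
begin

lemma gen_poly_eq: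
  "P n = (\<Sum>i\<le>n. monom (fact n / fact i * fps_nth (prefactor \<alpha> * exponent ^ i) n) i)"
proof -
  have "poly (P n) x =
      poly (\<Sum>i\<le>n. monom (fact n / fact i * fps_nth (prefactor \<alpha> * exponent ^ i) n) i) x" for x
  proof -
    have shift: "prefactor \<alpha> * (fps_const x * exponent) ^ i =
        fps_const (x ^ i) * (prefactor \<alpha> * exponent ^ i)" for i
      by (simp add: power_mult_distrib mult_ac)
    have "poly (P n) x / fact n = fps_nth (gen_fps \<alpha> x) n"
      by (simp add: gen)
    also have "\<dots> = (\<Sum>i\<le>n. x ^ i / fact i * fps_nth (prefactor \<alpha> * exponent ^ i) n)"
      unfolding gen_fps_eq by (subst fps_nth_mult_compose) (simp_all add: shift)
    finally show ?thesis
      by (simp add: poly_sum poly_monom field_simps sum_distrib_left sum_divide_distrib)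
  qed
  then show ?thesis
    by (simp add: poly_eq_poly_eq_iff[symmetric] fun_eq_iff)
qed

lemma gen_poly_0: "P 0 = 1"
  using gen_poly_eq[of 0] by (simp add: monom_0)

text \<open>Replacing \<open>x^i\<close> by the \<open>i\<close>-th moment turns \<open>exp (x s)\<close> into the moment generating function at
  \<open>s\<close>.\<close>

lemma moment_functional_gen_poly:
  "moment_functional (gamma_moment \<beta>) (P n) =
     fact n * fps_nth (transform \<alpha> \<beta>) n"
proof -
  have deg: "degree (P n) \<le> n"
    by (subst gen_poly_eq, rule degree_sum_le) (auto intro: order_trans[OF degree_monom_le])
  have co: "coeff (P n) i = fact n / fact i * fps_nth (prefactor \<alpha> * exponent ^ i) n"
    if "i \<le> n" for i
    using that by (subst gen_poly_eq) (simp add: coeff_sum)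
  show ?thesis
    by (simp add: moment_functional_eq[OF deg] co transform_def fps_nth_mult_compose moment_fps_def
        sum_distrib_left mult_ac)
qed

text \<open>These are the coefficients of \<open>t^n\<close> in \<open>gen_fps_deriv\<close>, multiplied by \<open>n!\<close>. The factors \<open>n\<close>
  and \<open>n - 1\<close> remove the terms with truncated indices.\<close>

lemma gen_poly_recurrence:
  "pCons 0 (P n) = smult (-1) (P (Suc n)) + smult (of_real (\<alpha> + 1) + 3 * of_nat n) (P n)
     - smult (of_nat n * (2 * of_real (\<alpha> + 1) + 3 * (of_nat n - 1))) (P (n - 1))
     + smult (of_nat n * (of_nat n - 1) * (of_nat n + of_real \<alpha> - 1)) (P (n - 2))"
proof -
  have "poly (pCons 0 (P n)) x = poly (smult (-1) (P (Suc n)) +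
      smult (of_real (\<alpha> + 1) + 3 * of_nat n) (P n)
     - smult (of_nat n * (2 * of_real (\<alpha> + 1) + 3 * (of_nat n - 1))) (P (n - 1))
     + smult (of_nat n * (of_nat n - 1) * (of_nat n + of_real \<alpha> - 1)) (P (n - 2))) x" for x
  proof -
    define g where "g = gen_fps \<alpha> x"
    have P: "poly (P m) x = fact m * fps_nth g m" for m
      by (simp add: g_def gen)
    have cube: "(1 - fps_X) ^ 3 * fps_deriv g = fps_deriv g - fps_const 3 * (fps_X * fps_deriv g)
        + fps_const 3 * (fps_X * (fps_X * fps_deriv g)) - fps_X * (fps_X * (fps_X * fps_deriv g))"
      by (simp add: power3_eq_cube algebra_simps flip: fps_numeral_fps_const)
    have square: "(fps_const a * (1 - fps_X) ^ 2 - fps_const x) * g = fps_const (a - x) * g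
        - fps_const (2 * a) * (fps_X * g) + fps_const a * (fps_X * (fps_X * g))" for a
      by (simp add: power2_eq_square algebra_simps flip: fps_numeral_fps_const fps_const_mult
          fps_const_sub)
    have nth: "fps_nth ((1 - fps_X) ^ 3 * fps_deriv g) n =
        fps_nth ((fps_const (of_real (\<alpha> + 1)) * (1 - fps_X) ^ 2 - fps_const x) * g) n"
      by (simp only: g_def gen_fps_deriv)
    consider "n = 0" | "n = 1" | m where "n = Suc (Suc m)"
      by (metis One_nat_def not0_implies_Suc)
    then show ?thesis
    proof cases
      case 1
      then show ?thesis
        using nth unfolding cube square by (simp add: P algebra_simps)
    next
      case 2
      then show ?thesis
        using nth unfolding cube square by (simp add: P algebra_simps)
    next
      case 3
      have "fps_nth ((1 - fps_X) ^ 3 * fps_deriv g) n = of_nat (m + 3) * fps_nth g (m + 3)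
          - 3 * of_nat (m + 2) * fps_nth g (m + 2) + 3 * of_nat (m + 1) * fps_nth g (m + 1)
          - of_nat m * fps_nth g m"
        unfolding cube by (cases m) (simp_all add: 3 eval_nat_numeral algebra_simps)
      moreover have "fps_nth ((fps_const (of_real (\<alpha> + 1)) * (1 - fps_X) ^ 2 - fps_const x) * g) n =
          (of_real (\<alpha> + 1) - x) * fps_nth g (m + 2)
          - 2 * of_real (\<alpha> + 1) * fps_nth g (m + 1) + of_real (\<alpha> + 1) * fps_nth g m"
        unfolding square by (simp add: 3 eval_nat_numeral)
      moreover note nth
      ultimately have "x * fps_nth g (m + 2) = - (of_nat (m + 3) * fps_nth g (m + 3))
          + (of_real (\<alpha> + 1) + 3 * of_nat (m + 2)) * fps_nth g (m + 2)
          - (2 * of_real (\<alpha> + 1) + 3 * of_nat (m + 1)) * fps_nth g (m + 1)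
          + (of_nat m + of_real (\<alpha> + 1)) * fps_nth g m"
        by (simp only: of_nat_add of_nat_numeral) algebra
      then have "fact (m + 2) * (x * fps_nth g (m + 2)) =
          fact (m + 2) * (- (of_nat (m + 3) * fps_nth g (m + 3))
          + (of_real (\<alpha> + 1) + 3 * of_nat (m + 2)) * fps_nth g (m + 2)
          - (2 * of_real (\<alpha> + 1) + 3 * of_nat (m + 1)) * fps_nth g (m + 1)
          + (of_nat m + of_real (\<alpha> + 1)) * fps_nth g m)"
        by (rule arg_cong)
      then show ?thesis
        unfolding 3 by (simp add: P eval_nat_numeral algebra_simps)
    qed
  qed
  then show ?thesis
    by (intro poly_eq_poly_eq_iff[THEN iffD1] ext)
qed

end

theorem theorem2p6:
  fixes \<alpha> :: real and P :: "nat \<Rightarrow> complex poly"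
  assumes "\<alpha> > -1"
    and "\<And>x :: complex. gen_fps \<alpha> x = Abs_fps (\<lambda>n. poly (P n) x / fact n)"
  shows "d_orthogonal 2 [u0 \<alpha>, u1 \<alpha>] P"
proof (rule d_orthogonal_of_recurrence[where a = "\<lambda>_. -1" and c = "\<lambda>n i.
      if i = 0 then of_real (\<alpha> + 1) + 3 * of_nat n
      else if i = 1 then - (of_nat n * (2 * of_real (\<alpha> + 1) + 3 * (of_nat n - 1)))
      else of_nat n * (of_nat n - 1) * (of_nat n + of_real \<alpha> - 1)"])
  note \<alpha> = assms(1) and gen = assms(2)
  have u0: "u0 \<beta> = moment_functional (gamma_moment \<beta>)" if "\<beta> \<in> {\<alpha>, \<alpha> + 1}" for \<beta>
    by (rule u0_eq_moment_functional) (use that \<alpha> in auto)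
  have lin: "linear_functional (u0 \<beta>)" if "\<beta> \<in> {\<alpha>, \<alpha> + 1}" for \<beta>
    by (simp only: u0[OF that] linear_functional_moment_functional)
  have u1: "u1 \<alpha> = (\<lambda>f. u0 \<alpha> f - u0 (\<alpha> + 1) f)"
    by (simp add: fun_eq_iff u1_eq_diff_u0[OF \<alpha>])
  have "linear_functional (u1 \<alpha>)"
    using lin unfolding u1 linear_functional_iff by (simp add: algebra_simps)
  then show "linear_functional u" if "u \<in> set [u0 \<alpha>, u1 \<alpha>]" for u
    using that lin by auto
  have u0_P: "u0 \<alpha> (P m) = (if m = 0 then 1 else 0)" for m
    by (simp add: u0 moment_functional_gen_poly[OF gen] transform_nth_same)
  moreover have u1_P: "u1 \<alpha> (P m) = (if m = 1 then 1 else 0)" for m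
    by (simp add: u1 u0 moment_functional_gen_poly[OF gen] transform_nth_same
        transform_nth_next)
  ultimately show "([u0 \<alpha>, u1 \<alpha>] ! k) (P m) = 0" if "k < 2" "m > k" for k m
    using that by (auto simp: less_2_cases_iff)
  show "([u0 \<alpha>, u1 \<alpha>] ! k) (P k) \<noteq> 0" if "k < 2" for k
    using that u0_P u1_P by (auto simp: less_2_cases_iff)
  show "P 0 = 1"
    by (rule gen_poly_0[OF gen])
  fix n :: nat
  have two: "{..2} = {0, 1, 2 :: nat}" by auto
  show "pCons 0 (P n) = smult (-1) (P (Suc n)) + (\<Sum>i\<le>2. smult (if i = 0 then of_real (\<alpha> + 1) + 3 * of_nat n
      else if i = 1 then - (of_nat n * (2 * of_real (\<alpha> + 1) + 3 * (of_nat n - 1)))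
      else of_nat n * (of_nat n - 1) * (of_nat n + of_real \<alpha> - 1)) (P (n - i)))"
    by (subst gen_poly_recurrence[OF gen]) (simp add: two)
  assume n: "2 \<le> n"
  then have "real n * (real n - 1) * (real n + \<alpha> - 1) \<noteq> 0"
    using \<alpha> by simp
  then have "complex_of_real (real n * (real n - 1) * (real n + \<alpha> - 1)) \<noteq> 0"
    by (simp only: of_real_eq_0_iff) simp
  then show "(if (2 :: nat) = 0 then of_real (\<alpha> + 1) + 3 * of_nat n
      else if (2 :: nat) = 1 then - (of_nat n * (2 * of_real (\<alpha> + 1) + 3 * (of_nat n - 1)))
      else complex_of_nat n * (of_nat n - 1) * (of_nat n + of_real \<alpha> - 1)) \<noteq> 0"
    by simp
qed simp_all

end
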